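(* Suppose that for infinitely many positive integers $t$ we have $P(2^t-1)>2^{0.75\,t}$. Then for every $\gamma>0$ there exists a family of three query locally decodable codes of length $\exp(n^\gamma)$; that is, there are constants $c>0$, $\delta>0$, $\epsilon<1/2$ such that for every $n\ge1$ there is a binary code $C_n:\{0,1\}^n\to\{0,1\}^{N_n}$ with $N_n\le e^{c\,n^{\gamma}}$ which is $(3,\delta,\epsilon)$-locally decodable.
   Context: $P(m)$ denotes the largest prime factor of the integer $m$. For binary strings, $d_H$ is Hamming distance. A binary code $C:\{0,1\}^n\to\{0,1\}^N$ is $(k,\delta,\epsilon)$-locally decodable if there is a randomized algorithm $\mathcal A$ which, given an index $i\in[n]$ and oracle access to a string $y\in\{0,1\}^N$, makes at most $k$ queries to $y$, and satisfies $\Pr[\mathcal A^y(i)=x_i]\ge 1-\epsilon$ for all $x\in\{0,1\}^n$, all $i\in[n]$ and all $y\in\{0,1\}^N$ with $d_H(C(x),y)\le \delta N$ (probability over the coin tosses of $\mathcal A$). The notation $\exp(x)$ means $e^{O(x)}$. *)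

theory Defs
  imports "HOL-Probability.Probability" "HOL-Computational_Algebra.Computational_Algebra"
begin

(* The value is unspecified for m = 0 and m = 1, which have no largest prime factor. *)
definition largest_prime_factor :: "nat \<Rightarrow> nat" where
  "largest_prime_factor m = Max (prime_factors m)"

(* Binary strings of length n are boolean lists of length n, with coordinates 0, ..., n - 1.
   The distance is only meaningful for lists of equal length. *)
definition hamming_dist :: "bool list \<Rightarrow> bool list \<Rightarrow> nat" where
  "hamming_dist x y = card {j. j < length x \<and> x ! j \<noteq> y ! j}"

(* A deterministic adaptive oracle algorithm: Query j t0 t1 asks for the bit at position j and
   continues with t0 if the answer is False and with t1 if it is True. *)
datatype query_alg = Output bool | Query nat query_alg query_alg

primrec run :: "query_alg \<Rightarrow> bool list \<Rightarrow> bool" where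
  "run (Output b) y = b"
| "run (Query j t0 t1) y = (if y ! j then run t1 y else run t0 y)"

primrec queries :: "query_alg \<Rightarrow> bool list \<Rightarrow> nat list" where
  "queries (Output b) y = []"
| "queries (Query j t0 t1) y = j # (if y ! j then queries t1 y else queries t0 y)"

definition makes_queries_le :: "query_alg \<Rightarrow> nat \<Rightarrow> nat \<Rightarrow> bool" where
  "makes_queries_le T N k \<longleftrightarrow>
     (\<forall>y. length y = N \<longrightarrow> length (queries T y) \<le> k \<and> set (queries T y) \<subseteq> {..<N})"

(* The randomized algorithm with input i is the distribution D i of the deterministic algorithm
   obtained once the coin tosses are fixed; the query bound holds for every outcome of the coins. *)
definition locally_decodable ::
  "nat \<Rightarrow> nat \<Rightarrow> (bool list \<Rightarrow> bool list) \<Rightarrow> nat \<Rightarrow> real \<Rightarrow> real \<Rightarrow> bool" where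
  "locally_decodable n N C k \<delta> \<epsilon> \<longleftrightarrow>
     (\<forall>x. length x = n \<longrightarrow> length (C x) = N) \<and>
     (\<exists>D :: nat \<Rightarrow> query_alg pmf.
        (\<forall>i<n. \<forall>T\<in>set_pmf (D i). makes_queries_le T N k) \<and>
        (\<forall>x i y. length x = n \<longrightarrow> i < n \<longrightarrow> length y = N \<longrightarrow>
           real (hamming_dist (C x) y) \<le> \<delta> * real N \<longrightarrow>
           measure_pmf.prob (D i) {T. run T y = x ! i} \<ge> 1 - \<epsilon>))"

end

theory Submission
  imports "HOL-Algebra.Algebraic_Closure_Type" "HOL-Library.Z2" "HOL-Number_Theory.Number_Theory" Defs
begin

text \<open>
  Let \<open>p\<close> be the largest prime factor of \<open>2 ^ t - 1\<close> and \<open>\<zeta>\<close> a primitive \<open>p\<close>-th root of unity in the field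
  with \<open>q = 2 ^ t\<close> elements. As \<open>p ^ 4 > q ^ 3\<close>, the additive characters of this field give a relation
  \<open>\<zeta> ^ a + \<zeta> ^ b + \<zeta> ^ c = 0\<close>, which the Frobenius map turns into
  \<open>\<zeta> ^ (a h) + \<zeta> ^ (b h) + \<zeta> ^ (c h) = 0\<close> for every power \<open>h\<close> of \<open>2\<close>, while for \<open>h = 0\<close> the sum is \<open>1\<close>.

  Take sets \<open>T i\<close> of size \<open>p\<close> whose pairwise intersections have sizes in \<open>{1..<p}\<close>, and let \<open>A i\<close> be the
  set of tuples of length \<open>(p - 1) div t\<close> over \<open>T i\<close>. Then \<open>card (A i \<inter> A j)\<close> is \<open>0\<close> modulo \<open>p\<close> for
  \<open>i = j\<close>, and otherwise a \<open>t\<close>-th root of unity modulo \<open>p\<close>, hence a power of \<open>2\<close>, because \<open>2\<close> has order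
  \<open>t\<close>. The codeword of \<open>x\<close> has at the vector \<open>w\<close> modulo \<open>p\<close> the entry
  \<open>\<Sum>j. x j * \<phi> (\<zeta> ^ \<langle>A j, w\<rangle>)\<close>, where \<open>\<phi>\<close> is additive with \<open>\<phi> 1 = 1\<close>. The sum of the entries at
  \<open>w + a A i\<close>, \<open>w + b A i\<close> and \<open>w + c A i\<close> is \<open>x i\<close> whenever \<open>\<langle>A i, w\<rangle> = 0\<close>, and for \<open>w\<close> uniform on
  this hyperplane no position is queried with a probability above \<open>3 p / N\<close>.
\<close>

section \<open>A three-term relation between roots of unity\<close>

lemma CHAR_bit: "CHAR(bit) = 2"
proof (rule CHAR_eqI)
  have *: "of_nat n = (of_bool (odd n) :: bit)" for n
    by (induction n) auto
  show "2 dvd n" if "of_nat n = (0 :: bit)" for n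
    using that unfolding * by (auto split: if_splits)
qed simp

abbreviation bit_scale :: "bit \<Rightarrow> bit alg_closure \<Rightarrow> bit alg_closure" where
  "bit_scale b x \<equiv> to_ac b * x"

lemma vector_space_bit_scale: "vector_space bit_scale"
  by unfold_locales (simp_all only: distrib_left distrib_right mult.assoc to_ac_add to_ac_mult to_ac_1 mult_1)

lemma vector_space_bit: "vector_space ((*) :: bit \<Rightarrow> bit \<Rightarrow> bit)"
  by unfold_locales (auto simp: algebra_simps)

text \<open>The vector \<open>1\<close> is independent over \<open>bit\<close>, so a linear
  functional can be prescribed on it. It serves twice: its sign is the additive character of the
  counting argument, and it turns field elements into bits.\<close>

lemma additive_functional:
  obtains \<phi> :: "bit alg_closure \<Rightarrow> bit" where "\<And>x y. \<phi> (x + y) = \<phi> x + \<phi> y" "\<phi> 1 = 1"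
proof -
  interpret V1: vector_space bit_scale by (rule vector_space_bit_scale)
  interpret V2: vector_space "(*) :: bit \<Rightarrow> bit \<Rightarrow> bit" by (rule vector_space_bit)
  interpret P: vector_space_pair bit_scale "(*) :: bit \<Rightarrow> bit \<Rightarrow> bit" ..
  have "V1.independent {1}"
    by (simp add: V1.dependent_single)
  from P.linear_independent_extend[OF this, of "\<lambda>_. 1"]
  obtain g where g: "Vector_Spaces.linear bit_scale (*) g" "g 1 = 1" by auto
  interpret g: Vector_Spaces.linear bit_scale "(*) :: bit \<Rightarrow> bit \<Rightarrow> bit" g by fact
  show ?thesis by (rule that[of g]) (use g in \<open>auto simp: g.add\<close>)
qed

lemma add_self_char2: "x + x = (0 :: bit alg_closure)"
  by (metis CHAR_bit CHAR_alg_closure mult_2 mult_zero_left of_nat_CHAR of_nat_numeral)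

lemma add_eq_0_char2: "x + y = (0 :: bit alg_closure) \<longleftrightarrow> x = y"
  by (metis add_self_char2 add_left_cancel)

lemma frobenius_char2: "(x + y) ^ (2 ^ j) = x ^ (2 ^ j) + (y :: bit alg_closure) ^ (2 ^ j)"
  using freshmans_dream'[where ?'a="bit alg_closure", of "2^j" j x y]
  by (simp add: CHAR_bit)

text \<open>A root of \<open>1 + x + ... + x ^ (p - 1)\<close> works; it is not \<open>1\<close>,
  because \<open>p\<close> is odd and so nonzero in characteristic 2.\<close>

lemma primitive_root_exists:
  assumes "prime p" "p > 2"
  obtains \<zeta> :: "bit alg_closure" where "\<zeta> ^ p = 1" "\<zeta> \<noteq> 1"
proof -
  have "\<exists>x::bit alg_closure. (\<Sum>k\<le>p-1. 1 * x ^ k) = 0"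
    using assms by (intro alg_closed) auto
  then obtain x :: "bit alg_closure" where x: "(\<Sum>k\<le>p-1. x ^ k) = 0" by auto
  have eq: "{..p-1} = {..<p}" using assms by auto
  have "x ^ p - 1 = (x - 1) * (\<Sum>k<p. x ^ k)"
    by (rule power_diff_1_eq)
  hence 1: "x ^ p = 1" using x eq by auto
  have "x \<noteq> 1"
  proof
    assume "x = 1"
    with x have "of_nat p = (0 :: bit alg_closure)" using assms by (simp)
    hence "2 dvd p" by (simp add: of_nat_eq_0_iff_char_dvd CHAR_bit)
    with assms show False by (metis prime_nat_iff less_irrefl numeral_eq_one_iff semiring_norm(85))
  qed
  with 1 that show ?thesis by blast
qed

text \<open>A coincidence gives \<open>\<zeta> ^ (j - i) = 1\<close> with \<open>j - i\<close> prime
  to \<open>p\<close>, and Bezout then forces \<open>\<zeta> = 1\<close>.\<close>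

lemma inj_on_powers:
  fixes \<zeta> :: "'a :: field"
  assumes "prime p" "\<zeta> ^ p = 1" "\<zeta> \<noteq> 1"
  shows "inj_on (\<lambda>s. \<zeta> ^ s) {..<p}"
proof (rule linorder_inj_onI')
  fix i j assume ij: "i \<in> {..<p}" "j \<in> {..<p}" "i < j"
  have nz: "\<zeta> \<noteq> 0" using assms prime_gt_0_nat[of p] by (auto simp: power_0_left)
  show "\<zeta> ^ i \<noteq> \<zeta> ^ j"
  proof
    assume "\<zeta> ^ i = \<zeta> ^ j"
    moreover have "\<zeta> ^ j = \<zeta> ^ i * \<zeta> ^ (j - i)" using ij by (simp flip: power_add)
    ultimately have 1: "\<zeta> ^ (j - i) = 1" using nz by auto
    have "coprime (j - i) p"
      using ij assms(1) by (metis coprime_commute diff_is_0_eq dvd_imp_le lessThan_iff less_imp_diff_less not_le prime_imp_coprime zero_less_diff)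
    then obtain u v where uv: "(j - i) * u = p * v + 1"
      using ij by (metis bezout_nat coprime_iff_gcd_eq_1 diff_is_0_eq not_le)
    have "\<zeta> ^ ((j - i) * u) = 1" by (simp add: power_mult 1)
    moreover have "\<zeta> ^ (p * v + 1) = \<zeta>" by (simp add: power_mult assms)
    ultimately show False using uv assms by auto
  qed
qed

text \<open>Each character sum \<open>\<eta> y\<close> over \<open>H\<close> with \<open>y \<noteq> 0\<close> is at most the square root of \<open>card F\<close>: it is
  constant on the coset \<open>y H\<close>, and its mean square over \<open>F\<close> is \<open>card H\<close>. Without a relation the sum
  of \<open>\<eta> y ^ 3\<close> over \<open>F\<close> would vanish, although \<open>\<eta> 0 ^ 3 = card H ^ 3\<close> dominates it.\<close>

lemma three_term_relation:
  fixes F H :: "bit alg_closure set"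
  assumes F: "finite F" "0 \<in> F" "\<And>x y. x \<in> F \<Longrightarrow> y \<in> F \<Longrightarrow> x + y \<in> F"
      "\<And>x y. x \<in> F \<Longrightarrow> y \<in> F \<Longrightarrow> x * y \<in> F" "\<And>x. x \<in> F \<Longrightarrow> inverse x \<in> F"
    and H: "H \<subseteq> F" "0 \<notin> H" "\<And>x y. x \<in> H \<Longrightarrow> y \<in> H \<Longrightarrow> x * y \<in> H" "H \<noteq> {}"
    and card: "real (card H) ^ 4 > real (card F) ^ 3"
  obtains x y z where "x \<in> H" "y \<in> H" "z \<in> H" "x + y + z = 0"
proof -
  obtain \<phi> :: "bit alg_closure \<Rightarrow> bit" where \<phi>: "\<And>x y. \<phi> (x + y) = \<phi> x + \<phi> y" "\<phi> 1 = 1"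
    using additive_functional by blast
  define \<psi> :: "bit alg_closure \<Rightarrow> real" where "\<psi> x = (if \<phi> x = 0 then 1 else -1)" for x
  define \<eta> where "\<eta> y = (\<Sum>h\<in>H. \<psi> (h * y))" for y
  have \<psi>0: "\<psi> 0 = 1" using \<phi>(1)[of 0 0] by (simp add: \<psi>_def)
  have \<psi>1: "\<psi> 1 = -1" using \<phi>(2) by (simp add: \<psi>_def)
  have \<psi>_add: "\<psi> (x + y) = \<psi> x * \<psi> y" for x y
    by (auto simp: \<psi>_def \<phi>)
  have finH: "finite H" using F(1) H(1) finite_subset by blast
  have orth: "(\<Sum>y\<in>F. \<psi> (x * y)) = (if x = 0 then real (card F) else 0)" if "x \<in> F" for x
  proof (cases "x = 0")
    case False
    have inv: "inverse x \<in> F" using F(5) that .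
    \<comment> \<open>Translation by \<open>inverse x\<close> multiplies each summand by
      \<open>\<psi> 1 = -1\<close>, so the sum equals its own negative.\<close>
    have bij: "bij_betw (\<lambda>y. y + inverse x) F F"
      by (rule bij_betw_byWitness[where f'="\<lambda>y. y + inverse x"])
         (use inv F(3) in \<open>auto simp: add.assoc add_self_char2\<close>)
    have "(\<Sum>y\<in>F. \<psi> (x * y)) = (\<Sum>y\<in>F. \<psi> (x * (y + inverse x)))"
      using sum.reindex_bij_betw[OF bij, of "\<lambda>y. \<psi> (x * y)"] by simp
    also have "\<dots> = (\<Sum>y\<in>F. - \<psi> (x * y))"
      using False by (intro sum.cong) (simp_all add: distrib_left \<psi>_add \<psi>1)
    finally show ?thesis using False by (simp add: sum_negf)
  qed (simp add: \<psi>0)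
  have pos: "card H > 0" using finH H(4) by (simp add: card_gt_0_iff)
  let ?p = "real (card H)" and ?q = "real (card F)"
  \<comment> \<open>Parseval: orthogonality leaves the pairs with \<open>h + g = 0\<close>, which
    means \<open>h = g\<close> in characteristic 2.\<close>
  have two: "(\<Sum>y\<in>F. \<eta> y ^ 2) = ?q * ?p"
  proof -
    have "(\<Sum>y\<in>F. \<eta> y ^ 2) = (\<Sum>y\<in>F. \<Sum>h\<in>H. \<Sum>g\<in>H. \<psi> ((h + g) * y))"
      by (simp add: \<eta>_def power2_eq_square sum_product distrib_right \<psi>_add)
    also have "\<dots> = (\<Sum>h\<in>H. \<Sum>g\<in>H. \<Sum>y\<in>F. \<psi> ((h + g) * y))"
      by (subst sum.swap, rule sum.cong[OF refl], rule sum.swap)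
    also have "\<dots> = (\<Sum>h\<in>H. \<Sum>g\<in>H. if h = g then ?q else 0)"
      using H(1) F(3) by (intro sum.cong refl) (subst orth, auto simp: add_eq_0_char2)
    also have "\<dots> = ?q * ?p" using finH by simp
    finally show ?thesis .
  qed
  have three: "(\<Sum>y\<in>F. \<eta> y ^ 3) = (\<Sum>h\<in>H. \<Sum>g\<in>H. \<Sum>k\<in>H. if h + g + k = 0 then ?q else 0)"
  proof -
    have "(\<Sum>y\<in>F. \<eta> y ^ 3) = (\<Sum>y\<in>F. \<Sum>h\<in>H. \<Sum>g\<in>H. \<Sum>k\<in>H. \<psi> ((h + g + k) * y))"
      by (simp add: \<eta>_def power3_eq_cube sum_product distrib_right \<psi>_add sum_distrib_right mult.assoc)
         (simp add: sum_distrib_left mult.assoc)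
    also have "\<dots> = (\<Sum>h\<in>H. \<Sum>g\<in>H. \<Sum>k\<in>H. \<Sum>y\<in>F. \<psi> ((h + g + k) * y))"
      by (subst sum.swap, rule sum.cong[OF refl], subst sum.swap, rule sum.cong[OF refl], rule sum.swap)
    also have "\<dots> = (\<Sum>h\<in>H. \<Sum>g\<in>H. \<Sum>k\<in>H. if h + g + k = 0 then ?q else 0)"
      using H(1) F(3) by (intro sum.cong refl orth) (meson subsetD)
    finally show ?thesis .
  qed
  have coset: "\<eta> (y * h) = \<eta> y" if "h \<in> H" for h y
  proof -
    have "inj_on (\<lambda>g. g * h) H" using that H(2) by (auto simp: inj_on_def)
    moreover from this have "(\<lambda>g. g * h) ` H = H"
      using that H(3) finH by (intro card_subset_eq) (auto simp: card_image)
    ultimately have "bij_betw (\<lambda>g. g * h) H H" by (simp add: bij_betw_def)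
    from sum.reindex_bij_betw[OF this, of "\<lambda>g. \<psi> (g * y)"] show ?thesis
      by (simp add: \<eta>_def mult_ac)
  qed
  have bound: "\<bar>\<eta> y\<bar> \<le> sqrt ?q" if "y \<in> F" "y \<noteq> 0" for y
  proof -
    have "?p * \<eta> y ^ 2 = (\<Sum>h\<in>H. \<eta> (y * h) ^ 2)" by (simp add: coset)
    also have "\<dots> = (\<Sum>z\<in>(\<lambda>h. y * h) ` H. \<eta> z ^ 2)"
      using that by (subst sum.reindex) (auto simp: inj_on_def)
    also have "\<dots> \<le> (\<Sum>z\<in>F. \<eta> z ^ 2)"
      using that H(1) F by (intro sum_mono2) auto
    finally have "\<eta> y ^ 2 \<le> ?q" using pos by (simp add: two mult.commute)
    thus ?thesis by (simp add: real_le_rsqrt)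
  qed
  have "\<exists>x\<in>H. \<exists>y\<in>H. \<exists>z\<in>H. x + y + z = 0"
  proof (rule ccontr)
    assume none: "\<not> ?thesis"
    have "(\<Sum>y\<in>F. \<eta> y ^ 3) = 0"
      unfolding three using none by (intro sum.neutral ballI) auto
    moreover have "(\<Sum>y\<in>F. \<eta> y ^ 3) = ?p ^ 3 + (\<Sum>y\<in>F-{0}. \<eta> y ^ 3)"
      using F(1,2) by (subst sum.remove[of _ 0]) (auto simp: \<eta>_def \<psi>0)
    ultimately have "?p ^ 3 = - (\<Sum>y\<in>F-{0}. \<eta> y ^ 3)" by simp
    also have "\<dots> = (\<Sum>y\<in>F-{0}. - (\<eta> y ^ 3))" by (simp add: sum_negf)
    \<comment> \<open>One factor of the cube is bounded pointwise; the other two are left for the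
      mean square \<open>two\<close>.\<close>
    also have "\<dots> \<le> (\<Sum>y\<in>F-{0}. sqrt ?q * \<eta> y ^ 2)"
    proof (rule sum_mono)
      fix y assume y: "y \<in> F - {0}"
      have "- (\<eta> y ^ 3) = (- \<eta> y) * \<eta> y ^ 2" by (simp add: power3_eq_cube power2_eq_square)
      also have "\<dots> \<le> sqrt ?q * \<eta> y ^ 2"
        using bound[of y] y by (intro mult_right_mono) auto
      finally show "- (\<eta> y ^ 3) \<le> sqrt ?q * \<eta> y ^ 2" .
    qed
    also have "\<dots> \<le> (\<Sum>y\<in>F. sqrt ?q * \<eta> y ^ 2)"
      using F(1) by (intro sum_mono2) auto
    also have "\<dots> = sqrt ?q * (?q * ?p)" by (simp flip: sum_distrib_left add: two)
    finally have "?p ^ 2 \<le> sqrt ?q * ?q" using pos by (simp add: power3_eq_cube power2_eq_square)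
    hence "(?p ^ 2) ^ 2 \<le> (sqrt ?q * ?q) ^ 2" by (intro power_mono) auto
    also have "\<dots> = ?q ^ 3" by (simp add: power_mult_distrib power3_eq_cube power2_eq_square)
    finally show False using card by (simp flip: power_mult)
  qed
  thus ?thesis using that by blast
qed

text \<open>The model is \<open>f s = \<phi> (\<zeta> ^ s)\<close> with \<open>\<zeta> ^ a + \<zeta> ^ b + \<zeta> ^ c = 0\<close>.\<close>

definition three_term_decoder :: "nat \<Rightarrow> (nat \<Rightarrow> bit) \<Rightarrow> nat \<Rightarrow> nat \<Rightarrow> nat \<Rightarrow> bool" where
  "three_term_decoder p f a b c \<longleftrightarrow> f 0 = 1 \<and> (\<forall>s. f (s mod p) = f s) \<and>
     (\<forall>s j. f (s + a * 2 ^ j) + f (s + b * 2 ^ j) + f (s + c * 2 ^ j) = 0)"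

text \<open>\<open>F\<close> is the fixed field of the \<open>t\<close>-fold Frobenius map and
  \<open>H\<close> the group generated by \<open>\<zeta>\<close>, which lies in \<open>F\<close>
  since \<open>p\<close> divides \<open>2 ^ t - 1\<close>.\<close>

lemma three_term_decoder_exists:
  assumes p: "prime p" "p dvd 2 ^ t - 1" and large: "real p > 2 powr (0.75 * real t)" and t: "t > 1"
  obtains f a b c where "three_term_decoder p f a b c"
proof -
  have "2 powr 1 \<le> (2 :: real) powr (0.75 * real t)"
    using t by (intro powr_mono) auto
  hence p2: "p > 2" using large by simp
  obtain \<zeta> :: "bit alg_closure" where \<zeta>: "\<zeta> ^ p = 1" "\<zeta> \<noteq> 1"
    using primitive_root_exists[OF p(1) p2] .
  obtain \<phi> :: "bit alg_closure \<Rightarrow> bit" where \<phi>: "\<And>x y. \<phi> (x + y) = \<phi> x + \<phi> y" "\<phi> 1 = 1"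
    using additive_functional by blast
  have \<phi>0: "\<phi> 0 = 0" using \<phi>(1)[of 0 0] by simp
  have \<zeta>mod: "\<zeta> ^ (s mod p) = \<zeta> ^ s" for s
    by (subst (2) mult_div_mod_eq[of p s, symmetric]) (simp only: power_add power_mult \<zeta>(1) power_one mult_1)
  have \<zeta>nz: "\<zeta> \<noteq> 0" using \<zeta>(1) p2 by (auto simp: power_0_left)
  define F where "F = {x :: bit alg_closure. x ^ (2 ^ t) = x}"
  define H where "H = (\<lambda>s. \<zeta> ^ s) ` {..<p}"
  have cardH: "card H = p"
    unfolding H_def using inj_on_powers[OF p(1) \<zeta>] by (simp add: card_image)
  have H_pow: "\<zeta> ^ s \<in> H" for s
    unfolding H_def using p2 by (subst \<zeta>mod[symmetric]) auto
  have finF: "finite F" "card F \<le> 2 ^ t"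
  proof -
    \<comment> \<open>In characteristic 2 the sign is immaterial, so the roots of \<open>P\<close>
      are the elements of \<open>F\<close>.\<close>
    define P :: "bit alg_closure poly" where "P = monom 1 (2 ^ t) + monom 1 1"
    have 1: "(1::nat) < 2 ^ t" using t by (intro one_less_power) auto
    have deg: "degree P = 2 ^ t"
      unfolding P_def by (subst degree_add_eq_left) (use 1 in \<open>auto simp: degree_monom_eq\<close>)
    hence "P \<noteq> 0" by auto
    have "F = {x. poly P x = 0}"
      by (auto simp: F_def P_def poly_monom add_eq_0_char2)
    thus "finite F" "card F \<le> 2 ^ t"
      using poly_roots_finite[OF \<open>P \<noteq> 0\<close>] card_poly_roots_bound[OF \<open>P \<noteq> 0\<close>] deg by auto
  qed
  have big: "real (card H) ^ 4 > real (card F) ^ 3"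
  proof -
    have "real (card F) ^ 3 \<le> (2 ^ t) ^ 3"
      using finF(2) by (intro power_mono) (simp_all flip: of_nat_le_iff)
    \<comment> \<open>The exponent 0.75 enters here, through 4 * 0.75 = 3.\<close>
    also have "\<dots> = (2 powr (0.75 * real t)) ^ 4"
      by (simp add: powr_realpow[symmetric] powr_powr mult.commute)
    also have "\<dots> < real p ^ 4" using large by (intro power_strict_mono) auto
    finally show ?thesis by (simp add: cardH)
  qed
  have HF: "H \<subseteq> F"
  proof -
    obtain d where "2 ^ t - 1 = p * d" using p(2) by auto
    hence "2 ^ t = p * d + 1" by (metis add.commute le_add_diff_inverse one_le_numeral one_le_power)
    hence "(\<zeta> ^ s) ^ (2 ^ t) = \<zeta> ^ s" for s
      by (simp add: power_add power_mult \<zeta> flip: power_mult)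
         (metis \<zeta>(1) mult.commute power_mult power_one)
    thus ?thesis by (auto simp: F_def H_def)
  qed
  obtain x y z where xyz: "x \<in> H" "y \<in> H" "z \<in> H" "x + y + z = 0"
  proof (rule three_term_relation[of F H])
    show "x * y \<in> H" if "x \<in> H" "y \<in> H" for x y
      using that H_pow unfolding H_def by (auto simp flip: power_add)
    show "H \<noteq> {}" using H_pow by auto
  qed (use finF big HF \<zeta>nz in \<open>auto simp: F_def H_def frobenius_char2 power_mult_distrib power_inverse\<close>)
  then obtain a b c where abc: "\<zeta> ^ a + \<zeta> ^ b + \<zeta> ^ c = 0"
    by (auto simp: H_def)
  define f where "f s = \<phi> (\<zeta> ^ s)" for s
  have "three_term_decoder p f a b c"
    unfolding three_term_decoder_def
  proof (intro conjI allI)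
    show "f 0 = 1" using \<phi> by (simp add: f_def)
    show "f (s mod p) = f s" for s by (simp add: f_def \<zeta>mod)
    show "f (s + a * 2 ^ j) + f (s + b * 2 ^ j) + f (s + c * 2 ^ j) = 0" for s j
    proof -
      have "\<zeta> ^ (s + a * 2 ^ j) + \<zeta> ^ (s + b * 2 ^ j) + \<zeta> ^ (s + c * 2 ^ j)
          = \<zeta> ^ s * (\<zeta> ^ a + \<zeta> ^ b + \<zeta> ^ c) ^ (2 ^ j)"
        by (simp add: frobenius_char2 power_add power_mult distrib_left)
      also have "\<dots> = 0" by (simp add: abc)
      finally have "\<phi> (\<zeta> ^ (s + a * 2 ^ j) + \<zeta> ^ (s + b * 2 ^ j) + \<zeta> ^ (s + c * 2 ^ j)) = 0"
        using \<phi>0 by metis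
      thus ?thesis unfolding f_def \<phi>(1) .
    qed
  qed
  thus ?thesis by (rule that)
qed

section \<open>Roots of unity modulo a prime\<close>

text \<open>A proper divisor \<open>d\<close> of \<open>t\<close> is at most \<open>t / 2\<close>;
  as the order of 2 it would give \<open>p \<le> 2 ^ d\<close>, against the lower bound on
  \<open>p\<close>.\<close>

lemma order_two_mod:
  assumes p: "prime p" "p dvd 2 ^ t - 1" and large: "real p > 2 powr (0.75 * real t)" and t: "t > 1"
  shows "ord p 2 = t"
proof -
  have "[2 ^ t = 1] (mod p)" using p(2) by (metis cong_altdef_nat one_le_numeral one_le_power)
  hence dvd: "ord p 2 dvd t" by (subst (asm) ord_divides)
  show ?thesis
  proof (rule ccontr)
    assume ne: "ord p 2 \<noteq> t"
    obtain d where d: "t = ord p 2 * d" using dvd by auto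
    with ne t have o: "2 * ord p 2 \<le> t" "ord p 2 > 0"
      by (cases d; cases "d - 1"; force)+
    have "[2 ^ ord p 2 = 1] (mod p)" by (rule ord)
    hence "p dvd 2 ^ ord p 2 - 1" by (metis cong_altdef_nat one_le_numeral one_le_power)
    hence "p \<le> 2 ^ ord p 2 - 1" using one_less_power[of "2::nat" "ord p 2"] o by (intro dvd_imp_le) auto
    hence "p \<le> 2 ^ ord p 2" by simp
    hence "real p \<le> real (2 ^ ord p 2)" by (simp only: of_nat_le_iff)
    hence "real p \<le> 2 powr real (ord p 2)" by (simp add: powr_realpow)
    also have "\<dots> \<le> 2 powr (0.75 * real t)" using o by (intro powr_mono) auto
    finally show False using large by simp
  qed
qed

text \<open>With \<open>m = ord p g\<close>, the congruence \<open>x ^ m = 1\<close> has at most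
  \<open>m\<close> solutions modulo a prime, and the \<open>m\<close> distinct powers of
  \<open>g\<close> exhaust them.\<close>

lemma roots_of_unity_mod_powers:
  fixes h g :: nat
  assumes p: "prime p" and o: "ord p g > 0" and h: "[h ^ ord p g = 1] (mod p)"
  shows "\<exists>j. [h = g ^ j] (mod p)"
proof -
  let ?R = "{x \<in> {..<p}. [x ^ ord p g = 1] (mod p)}"
  have cop: "coprime p g" using o by (metis ord_eq_0 less_irrefl)
  have "card ?R \<le> card ((\<lambda>k. g ^ k mod p) ` {..<ord p g})"
    using roots_mod_prime_bound[of p "ord p g" 1] p o inj_power_mod[OF cop] by (subst card_image) auto
  moreover have "(\<lambda>k. g ^ k mod p) ` {..<ord p g} \<subseteq> ?R"
  proof safe
    fix k
    have "[(g ^ ord p g) ^ k = 1 ^ k] (mod p)"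
      by (intro cong_pow ord)
    moreover have "(g ^ ord p g) ^ k = (g ^ k) ^ ord p g"
      by (simp only: power_mult [symmetric] mult.commute)
    ultimately have "[(g ^ k) ^ ord p g = 1] (mod p)" by simp
    thus "[(g ^ k mod p) ^ ord p g = 1] (mod p)"
      unfolding unique_euclidean_semiring_class.cong_def power_mod .
  qed (use prime_gt_0_nat[OF p] in auto)
  ultimately have "(\<lambda>k. g ^ k mod p) ` {..<ord p g} = ?R"
    by (intro card_seteq) auto
  moreover have "h mod p \<in> ?R"
    using h prime_gt_0_nat[OF p] by (auto simp: unique_euclidean_semiring_class.cong_def power_mod)
  ultimately obtain k where "h mod p = g ^ k mod p" by (metis (no_types, lifting) imageE)
  thus ?thesis unfolding unique_euclidean_semiring_class.cong_def by blast
qed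

section \<open>Codes from matching families\<close>

text \<open>This is \<open>w\<close> plus \<open>e\<close> times the indicator of \<open>A\<close>,
  modulo \<open>p\<close>. Vectors are extensional on \<open>U\<close>, so that equal coordinates
  mean equal functions.\<close>

definition shift :: "nat \<Rightarrow> 'a set \<Rightarrow> 'a set \<Rightarrow> nat \<Rightarrow> ('a \<Rightarrow> nat) \<Rightarrow> 'a \<Rightarrow> nat" where
  "shift p U A e w = (\<lambda>\<tau>\<in>U. (w \<tau> + of_bool (\<tau> \<in> A) * e) mod p)"

lemma shift_in_PiE: "p > 0 \<Longrightarrow> shift p U A e w \<in> U \<rightarrow>\<^sub>E {..<p}"
  by (auto simp: shift_def)

text \<open>The added indicator cancels modulo \<open>p\<close>. Hence a corrupted position spoils a
  given query for at most one \<open>w\<close>.\<close>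

lemma inj_on_shift: "inj_on (shift p U A e) (U \<rightarrow>\<^sub>E {..<p})"
proof (rule inj_onI)
  fix v w assume vw: "v \<in> U \<rightarrow>\<^sub>E {..<p}" "w \<in> U \<rightarrow>\<^sub>E {..<p}" "shift p U A e v = shift p U A e w"
  show "v = w"
  proof (rule PiE_ext[OF vw(1,2)])
    fix \<tau> assume \<tau>: "\<tau> \<in> U"
    have "[v \<tau> + of_bool (\<tau> \<in> A) * e = w \<tau> + of_bool (\<tau> \<in> A) * e] (mod p)"
      using fun_cong[OF vw(3), of \<tau>] \<tau> unfolding shift_def unique_euclidean_semiring_class.cong_def by simp
    hence "[v \<tau> = w \<tau>] (mod p)" by (simp only: cong_add_rcancel_nat)
    moreover have "v \<tau> < p" "w \<tau> < p" using vw(1,2) \<tau> by (auto simp: PiE_iff)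
    ultimately show "v \<tau> = w \<tau>" by (rule cong_less_modulus_unique_nat)
  qed
qed

lemma sum_shift:
  assumes "finite U" "B \<subseteq> U"
  shows "[(\<Sum>\<tau>\<in>B. shift p U A e w \<tau>) = (\<Sum>\<tau>\<in>B. w \<tau>) + e * card (B \<inter> A)] (mod p)"
proof -
  have fin: "finite B" using assms finite_subset by blast
  have "[(\<Sum>\<tau>\<in>B. shift p U A e w \<tau>) = (\<Sum>\<tau>\<in>B. w \<tau> + of_bool (\<tau> \<in> A) * e)] (mod p)"
    using assms by (intro cong_sum) (auto simp: shift_def unique_euclidean_semiring_class.cong_def)
  also have "(\<Sum>\<tau>\<in>B. w \<tau> + of_bool (\<tau> \<in> A) * e) = (\<Sum>\<tau>\<in>B. w \<tau>) + e * card (B \<inter> A)"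
    using fin by (simp add: sum.distrib mult.commute sum_of_bool_eq flip: sum_distrib_right)
  finally show ?thesis .
qed

text \<open>All coordinates but one in \<open>A\<close> are free, and that one can be solved
  for.\<close>

lemma card_hyperplane_ge:
  assumes U: "finite U" "A \<subseteq> U" "A \<noteq> {}" and p: "p > 0"
  shows "p ^ card U \<le> p * card {w \<in> U \<rightarrow>\<^sub>E {..<p}. p dvd (\<Sum>\<tau>\<in>A. w \<tau>)}"
proof -
  obtain \<tau>0 where \<tau>0: "\<tau>0 \<in> A" using U by blast
  hence \<tau>U: "\<tau>0 \<in> U" using U by blast
  have finA: "finite A" using U finite_subset by blast
  let ?H = "{w \<in> U \<rightarrow>\<^sub>E {..<p}. p dvd (\<Sum>\<tau>\<in>A. w \<tau>)}"
  \<comment> \<open>The factor \<open>p - 1\<close> stands for \<open>-1\<close> modulo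
    \<open>p\<close>, which keeps the computation in the naturals.\<close>
  define ext where "ext u = u(\<tau>0 := ((p - 1) * (\<Sum>\<tau>\<in>A-{\<tau>0}. u \<tau>)) mod p)" for u :: "'a \<Rightarrow> nat"
  have "card ((U - {\<tau>0}) \<rightarrow>\<^sub>E {..<p}) \<le> card ?H"
  proof (rule card_inj_on_le)
    show "inj_on ext ((U - {\<tau>0}) \<rightarrow>\<^sub>E {..<p})"
    proof (rule inj_onI)
      fix u v assume uv: "u \<in> (U - {\<tau>0}) \<rightarrow>\<^sub>E {..<p}" "v \<in> (U - {\<tau>0}) \<rightarrow>\<^sub>E {..<p}" "ext u = ext v"
      show "u = v"
      proof (rule PiE_ext[OF uv(1,2)])
        fix \<tau> assume "\<tau> \<in> U - {\<tau>0}"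
        thus "u \<tau> = v \<tau>" using fun_cong[OF uv(3), of \<tau>] by (simp add: ext_def)
      qed
    qed
    show "ext ` ((U - {\<tau>0}) \<rightarrow>\<^sub>E {..<p}) \<subseteq> ?H"
    proof (rule image_subsetI)
      fix u assume u: "u \<in> (U - {\<tau>0}) \<rightarrow>\<^sub>E {..<p}"
      have "ext u \<in> U \<rightarrow>\<^sub>E {..<p}"
        using u p \<tau>U unfolding ext_def by (auto simp: PiE_iff extensional_def)
      moreover have "p dvd (\<Sum>\<tau>\<in>A. ext u \<tau>)"
      proof -
        let ?S = "\<Sum>\<tau>\<in>A-{\<tau>0}. u \<tau>"
        have "(\<Sum>\<tau>\<in>A. ext u \<tau>) = ((p - 1) * ?S) mod p + ?S"
          using finA \<tau>0 by (subst sum.remove[of _ \<tau>0]) (auto simp: ext_def intro!: sum.cong)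
        also have "[\<dots> = (p - 1) * ?S + ?S] (mod p)"
          unfolding unique_euclidean_semiring_class.cong_def by (rule mod_add_left_eq)
        also have "(p - 1) * ?S + ?S = p * ?S"
          using p by (cases p) auto
        finally show ?thesis by (simp add: cong_dvd_iff)
      qed
      ultimately show "ext u \<in> ?H" by blast
    qed
    show "finite ?H" using U by (intro finite_subset[OF _ finite_PiE[of U "\<lambda>_. {..<p}"]]) auto
  qed
  also have "card ((U - {\<tau>0}) \<rightarrow>\<^sub>E {..<p}) = p ^ (card U - 1)"
    using U \<tau>U by (simp add: card_PiE)
  finally have "p * p ^ (card U - 1) \<le> p * card ?H" by (rule mult_le_mono2)
  moreover have "card U > 0" using U \<tau>U by (auto simp: card_gt_0_iff)
  ultimately show ?thesis by (simp flip: power_Suc)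
qed

text \<open>A decision tree has no memory, so the parity of the answers so far is carried by the
  choice of the subtree.\<close>

definition xor_query :: "nat \<Rightarrow> nat \<Rightarrow> nat \<Rightarrow> query_alg" where
  "xor_query q r s =
     (let t = (\<lambda>u. Query s (Output u) (Output (\<not> u)));
          t' = (\<lambda>u. Query r (t u) (t (\<not> u)))
      in Query q (t' False) (t' True))"

lemma run_xor_query: "run (xor_query q r s) y = ((y ! q \<noteq> y ! r) \<noteq> y ! s)"
  by (simp add: xor_query_def Let_def)

lemma makes_queries_le_xor_query:
  "q < N \<Longrightarrow> r < N \<Longrightarrow> s < N \<Longrightarrow> makes_queries_le (xor_query q r s) N 3"
  by (simp add: makes_queries_le_def xor_query_def Let_def)

lemma bit_of_bool_xor: "((b :: bit) = 1) \<noteq> (c = 1) \<longleftrightarrow> b + c = 1"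
  by (cases b; cases c) auto

text \<open>The coins choose \<open>w\<close> in the hyperplane \<open>H i\<close>. Each of the
  three queries is corrupted for at most \<open>N / (12 p)\<close> choices, so at most
  \<open>N / (4 p)\<close> of them are bad, which is at most a quarter of
  \<open>H i\<close>.\<close>

lemma locally_decodable_matching_family:
  fixes A :: "nat \<Rightarrow> 'a set" and f :: "nat \<Rightarrow> bit"
  assumes U: "finite U" and p: "p > 0"
    and A: "\<And>i. i < n \<Longrightarrow> A i \<subseteq> U" "\<And>i. i < n \<Longrightarrow> A i \<noteq> {}" "\<And>i. i < n \<Longrightarrow> p dvd card (A i)"
    and AA: "\<And>i j. i < n \<Longrightarrow> j < n \<Longrightarrow> i \<noteq> j \<Longrightarrow> \<exists>l. [card (A i \<inter> A j) = 2 ^ l] (mod p)"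
    and dec: "three_term_decoder p f a b c"
  shows "\<exists>C. locally_decodable n (p ^ card U) C 3 (1 / (12 * real p)) (1 / 4)"
proof -
  have f: "f 0 = 1" "\<And>s. f (s mod p) = f s"
      "\<And>s l. f (s + a * 2 ^ l) + f (s + b * 2 ^ l) + f (s + c * 2 ^ l) = 0"
    using dec by (auto simp only: three_term_decoder_def)
  define N where "N = p ^ card U"
  define V where "V = U \<rightarrow>\<^sub>E {..<p}"
  have finV: "finite V" unfolding V_def using U by (intro finite_PiE) auto
  have cardV: "card V = N" using U by (simp add: V_def N_def card_PiE)
  obtain pos where pos: "bij_betw pos V {..<N}"
    using finV cardV by (metis ex_bij_betw_finite_nat atLeast0LessThan)
  have pos_less: "pos w < N" if "w \<in> V" for w
    using pos that by (auto simp: bij_betw_def)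
  define ip where "ip i w = (\<Sum>\<tau>\<in>A i. w \<tau>)" for i and w :: "'a \<Rightarrow> nat"
  define g where "g x w = (\<Sum>j<n. of_bool (x ! j) * f (ip j w))" for x w
  define C where "C x = map (\<lambda>q. g x (the_inv_into V pos q) = 1) [0..<N]" for x
  have C_pos: "C x ! pos w = (g x w = 1)" if "w \<in> V" for x w
    using pos_less[OF that] that bij_betw_imp_inj_on[OF pos] by (simp add: C_def the_inv_into_f_f)
  define sh where "sh i e w = shift p U (A i) e w" for i e w
  have sh_V: "sh i e w \<in> V" for i e w
    using shift_in_PiE[OF p] by (simp add: sh_def V_def)
  have sh_inj: "inj_on (sh i e) V" for i e
    using inj_on_shift[of p U "A i" e] by (simp add: sh_def[abs_def] V_def)
  define H where "H i = {w \<in> V. p dvd ip i w}" for i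
  have H_ge: "N \<le> p * card (H i)" if "i < n" for i
    using card_hyperplane_ge[OF U A(1,2)[OF that] p] by (simp add: H_def V_def ip_def N_def)
  have finH: "finite (H i)" for i using finV by (simp add: H_def)
  have N0: "N > 0" using p by (simp add: N_def)
  have H_ne: "H i \<noteq> {}" if "i < n" for i using H_ge[OF that] N0 by auto
  define T where "T i w = xor_query (pos (sh i a w)) (pos (sh i b w)) (pos (sh i c w))" for i w
  define D where "D i = map_pmf (T i) (pmf_of_set (H i))" for i

  have f_cong: "f s = f t" if "[s = t] (mod p)" for s t
    using f(2)[of s] f(2)[of t] that unfolding unique_euclidean_semiring_class.cong_def by simp
  have f_sh: "f (ip j (sh i e w)) = f (ip j w + e * card (A j \<inter> A i))" if "i < n" "j < n" for i j e w
    unfolding ip_def sh_def using sum_shift[OF U A(1)[OF that(2)]] by (rule f_cong)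

  have decode: "g x (sh i a w) + g x (sh i b w) + g x (sh i c w) = of_bool (x ! i)"
    if i: "i < n" and w: "w \<in> H i" for x i w
  proof -
    have summand: "f (ip j (sh i a w)) + f (ip j (sh i b w)) + f (ip j (sh i c w)) = of_bool (j = i)"
      if j: "j < n" for j
    proof (cases "j = i")
      case True
      \<comment> \<open>Both \<open>ip i w\<close> and \<open>card (A i)\<close> vanish modulo
        \<open>p\<close>, so all three values are \<open>f 0 = 1\<close>, and
        \<open>1 + 1 + 1 = 1\<close> in \<open>bit\<close>.\<close>
      have "[ip i w + e * card (A i \<inter> A i) = 0] (mod p)" for e
        using w A(3)[OF i] by (simp add: H_def cong_0_iff)
      hence "f (ip i w + e * card (A i \<inter> A i)) = 1" for e
        using f_cong f(1) by metis
      thus ?thesis using True by (simp add: f_sh i)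
    next
      case False
      obtain l where l: "[card (A j \<inter> A i) = 2 ^ l] (mod p)" using AA[OF j i False] by blast
      have "f (ip j (sh i e w)) = f (ip j w + e * 2 ^ l)" for e
        unfolding f_sh[OF i j] by (intro f_cong cong_add cong_mult l cong_refl)
      thus ?thesis using f(3) False by simp
    qed
    have "g x (sh i a w) + g x (sh i b w) + g x (sh i c w)
        = (\<Sum>j<n. of_bool (x ! j) * (f (ip j (sh i a w)) + f (ip j (sh i b w)) + f (ip j (sh i c w))))"
      by (simp only: g_def distrib_left sum.distrib)
    also have "\<dots> = (\<Sum>j<n. if j = i then of_bool (x ! j) else 0)"
      by (intro sum.cong refl) (use summand in auto)
    also have "\<dots> = of_bool (x ! i)" using i by simp
    finally show ?thesis .
  qed

  have "locally_decodable n N C 3 (1 / (12 * real p)) (1 / 4)"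
    unfolding locally_decodable_def
  proof (intro conjI exI[of _ D] allI impI ballI)
    show "length (C x) = N" for x by (simp add: C_def)
  next
    fix i S assume i: "i < n" and "S \<in> set_pmf (D i)"
    then obtain w where "S = T i w" using H_ne finH by (auto simp: D_def)
    thus "makes_queries_le S N 3" by (simp add: T_def makes_queries_le_xor_query pos_less sh_V)
  next
    fix x i y
    assume i: "i < n" and y: "real (hamming_dist (C x) y) \<le> 1 / (12 * real p) * real N"
    define E where "E = {j. j < N \<and> C x ! j \<noteq> y ! j}"
    have cardE: "card E = hamming_dist (C x) y" by (simp add: E_def hamming_dist_def C_def)
    define Bad where "Bad e = {w \<in> H i. pos (sh i e w) \<in> E}" for e
    have card_Bad: "card (Bad e) \<le> card E" for e
    proof (rule card_inj_on_le[where f = "\<lambda>w. pos (sh i e w)"])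
      have "inj_on (pos \<circ> sh i e) V"
        using sh_inj sh_V bij_betw_imp_inj_on[OF pos] by (intro comp_inj_on) (auto intro: inj_on_subset)
      thus "inj_on (\<lambda>w. pos (sh i e w)) (Bad e)"
        unfolding comp_def by (rule inj_on_subset) (auto simp: Bad_def H_def)
      show "finite E" by (simp add: E_def)
    qed (auto simp: Bad_def)
    have correct: "run (T i w) y = x ! i" if w: "w \<in> H i - (Bad a \<union> Bad b \<union> Bad c)" for w
    proof -
      have "y ! pos (sh i e w) = (g x (sh i e w) = 1)" if "e \<in> {a, b, c}" for e
        using w that pos_less[OF sh_V, of i e w] C_pos[OF sh_V, of x i e w] by (auto simp: Bad_def E_def)
      hence "run (T i w) y = (g x (sh i a w) + g x (sh i b w) + g x (sh i c w) = 1)"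
        by (simp add: T_def run_xor_query bit_of_bool_xor del: bit_not_one_iff)
      moreover have "w \<in> H i" using w by simp
      ultimately show ?thesis by (simp only: decode[OF i] of_bool_eq_1_iff)
    qed
    let ?h = "real (card (H i))"
    have hpos: "?h > 0" using H_ne[OF i] finH by (simp add: card_gt_0_iff)
    have "real (card (Bad a \<union> Bad b \<union> Bad c)) \<le> real (card (Bad a) + card (Bad b) + card (Bad c))"
      by (intro of_nat_mono order.trans[OF card_Un_le] add_mono card_Un_le) simp
    also have "\<dots> \<le> 3 * real (card E)" using card_Bad[of a] card_Bad[of b] card_Bad[of c] by simp
    also have "\<dots> \<le> real N / (4 * real p)" using y by (simp add: cardE)
    also have "\<dots> \<le> real (p * card (H i)) / (4 * real p)"
      by (intro divide_right_mono of_nat_mono H_ge i) auto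
    also have "\<dots> = ?h / 4" using p by simp
    finally have bad: "real (card (Bad a \<union> Bad b \<union> Bad c)) \<le> ?h / 4" .
    have "1 - 1 / 4 \<le> (?h - real (card (Bad a \<union> Bad b \<union> Bad c))) / ?h"
      using bad hpos by (simp add: field_simps)
    also have "?h - real (card (Bad a \<union> Bad b \<union> Bad c)) = real (card (H i - (Bad a \<union> Bad b \<union> Bad c)))"
    proof -
      have "Bad a \<union> Bad b \<union> Bad c \<subseteq> H i" by (auto simp: Bad_def)
      with finH[of i] show ?thesis
        by (simp only: card_Diff_subset finite_subset card_mono of_nat_diff)
    qed
    also have "\<dots> / ?h \<le> real (card (H i \<inter> {w. run (T i w) y = x ! i})) / ?h"
      by (intro divide_right_mono of_nat_mono card_mono) (use finH correct in auto)
    also have "\<dots> = measure_pmf.prob (D i) {S. run S y = x ! i}"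
      using H_ne[OF i] finH[of i] by (simp add: D_def measure_pmf_of_set vimage_def)
    finally show "measure_pmf.prob (D i) {S. run S y = x ! i} \<ge> 1 - 1 / 4" .
  qed
  thus ?thesis unfolding N_def by blast
qed

section \<open>A matching family and its parameters\<close>

text \<open>Each \<open>T i\<close> is the graph of its own function from \<open>p - 1\<close>
  points to \<open>k\<close> values, together with one common point. The common point makes
  intersections nonempty; a disagreement of the functions keeps them below \<open>p\<close>.\<close>

lemma set_family_with_small_intersections:
  assumes "n \<le> k ^ (p - 1)" "p > 0" "k > 0"
  shows "\<exists>T :: nat \<Rightarrow> (nat \<times> nat) set. \<forall>i<n. T i \<subseteq> {..<p} \<times> {..<k} \<and> card (T i) = p \<and>
    (\<forall>j<n. i \<noteq> j \<longrightarrow> card (T i \<inter> T j) \<in> {1..<p})"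
proof -
  let ?G = "{..<p-1} \<rightarrow>\<^sub>E {..<k}"
  have finG: "finite ?G" by (intro finite_PiE) auto
  have "card {..<n} \<le> card ?G" using assms by (simp add: card_PiE)
  then obtain g where g: "g ` {..<n} \<subseteq> ?G" "inj_on g {..<n}"
    using card_le_inj[of "{..<n}" ?G] finG by auto
  define T where "T i = insert (p - 1, 0) ((\<lambda>l. (l, g i l)) ` {..<p-1})" for i
  have finT: "finite (T i)" for i by (simp add: T_def)
  have cardT: "card (T i) = p" for i
    unfolding T_def using assms(2)
    by (subst card_insert_disjoint) (auto simp: card_image inj_on_def)
  have sub: "T i \<subseteq> {..<p} \<times> {..<k}" if "i < n" for i
  proof -
    have "g i \<in> ?G" using g(1) that by auto
    thus ?thesis using assms(2,3) by (auto simp: T_def PiE_iff)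
  qed
  have "card (T i \<inter> T j) \<in> {1..<p}" if ij: "i < n" "j < n" "i \<noteq> j" for i j
  proof -
    have "g i \<noteq> g j" using g(2) ij by (auto simp: inj_on_def)
    moreover have "g i \<in> ?G" "g j \<in> ?G" using g(1) ij by auto
    ultimately obtain l where l: "l < p - 1" "g i l \<noteq> g j l"
      by (metis PiE_ext lessThan_iff)
    have "(l, g i l) \<in> T i" using l by (simp add: T_def)
    moreover have "(l, g i l) \<notin> T j" using l by (auto simp: T_def)
    ultimately have "T i \<inter> T j \<subset> T i" by blast
    hence "card (T i \<inter> T j) < p" using psubset_card_mono[OF finT] cardT by metis
    moreover have "(p - 1, 0) \<in> T i \<inter> T j" by (simp add: T_def)
    hence "card (T i \<inter> T j) > 0" using finT by (auto simp: card_gt_0_iff)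
    ultimately show ?thesis by auto
  qed
  with sub cardT show ?thesis by (intro exI[of _ T] allI impI conjI)
qed

text \<open>Passing from \<open>T i\<close> to lists of length \<open>D\<close> raises all
  intersection sizes to the power \<open>D\<close>; the universe of \<open>(p * k) ^ D\<close> lists
  determines the code length.\<close>

lemma locally_decodable_prime_factor:
  assumes p: "prime p" "p dvd 2 ^ t - 1" and large: "real p > 2 powr (0.75 * real t)" and t: "t > 1"
    and n: "n \<le> k ^ (p - 1)" and k: "k > 0"
  shows "\<exists>C. locally_decodable n (p ^ ((p * k) ^ ((p - 1) div t))) C 3 (1 / (12 * real p)) (1 / 4)"
proof -
  define D where "D = (p - 1) div t"
  have p0: "p > 1" using prime_gt_1_nat[OF p(1)] .
  have ord: "ord p 2 = t" using order_two_mod[OF p large t] .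
  have "coprime p 2" using ord t by (metis ord_eq_0 less_nat_zero_code)
  \<comment> \<open>The order of 2 divides \<open>p - 1\<close>, so the division defining
    \<open>D\<close> is exact.\<close>
  hence tp: "t dvd p - 1"
    using order_divides_totient[of p 2] ord totient_prime[OF p(1)] by simp
  hence Dt: "D * t = p - 1" by (simp add: D_def)
  hence D0: "D > 0" using p0 by (cases D) auto
  obtain f a b c where f: "three_term_decoder p f a b c"
    using three_term_decoder_exists[OF p large t] .
  obtain T :: "nat \<Rightarrow> (nat \<times> nat) set" where
    *: "\<forall>i<n. T i \<subseteq> {..<p} \<times> {..<k} \<and> card (T i) = p \<and>
      (\<forall>j<n. i \<noteq> j \<longrightarrow> card (T i \<inter> T j) \<in> {1..<p})"
    using set_family_with_small_intersections[OF n less_trans[OF zero_less_one p0] k] by (rule exE)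
  have T: "T i \<subseteq> {..<p} \<times> {..<k}" "card (T i) = p"
      "j < n \<Longrightarrow> i \<noteq> j \<Longrightarrow> card (T i \<inter> T j) \<in> {1..<p}" if "i < n" for i j
    using * that by blast+
  define L where "L S = {xs. set xs \<subseteq> S \<and> length xs = D}" for S :: "(nat \<times> nat) set"
  have finT: "finite (T i)" if "i < n" for i using T(1)[OF that] by (rule finite_subset) auto
  have cardL: "card (L S) = card S ^ D" if "finite S" for S
    using card_lists_length_eq[OF that] by (simp add: L_def)
  have "\<exists>C. locally_decodable n (p ^ card (L ({..<p} \<times> {..<k}))) C 3 (1 / (12 * real p)) (1 / 4)"
  proof (rule locally_decodable_matching_family[where A = "\<lambda>i. L (T i)", OF _ _ _ _ _ _ f])
    show "finite (L ({..<p} \<times> {..<k}))" unfolding L_def by (rule finite_lists_length_eq) auto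
    show "p > 0" using p0 by simp
    show "L (T i) \<subseteq> L ({..<p} \<times> {..<k})" if "i < n" for i using T(1)[OF that] by (auto simp: L_def)
    have card: "card (L (T i)) = p ^ D" if "i < n" for i using cardL[OF finT] T(2) that by simp
    show "L (T i) \<noteq> {}" if "i < n" for i using card[OF that] p0 by auto
    show "p dvd card (L (T i))" if "i < n" for i using card[OF that] D0 by simp
    show "\<exists>l. [card (L (T i) \<inter> L (T j)) = 2 ^ l] (mod p)" if ij: "i < n" "j < n" "i \<noteq> j" for i j
    proof -
      let ?h = "card (T i \<inter> T j)"
      have "L (T i) \<inter> L (T j) = L (T i \<inter> T j)" by (auto simp: L_def)
      hence eq: "card (L (T i) \<inter> L (T j)) = ?h ^ D" using cardL finT ij by simp
      \<comment> \<open>Fermat applies because \<open>0 < ?h < p\<close>, and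
        \<open>?h ^ (p - 1)\<close> is the \<open>t\<close>-th power of
        \<open>?h ^ D\<close>.\<close>
      have "\<not> p dvd ?h" using T(3)[OF ij] by (auto dest: dvd_imp_le)
      hence "[?h ^ (p - 1) = 1] (mod p)" by (rule fermat_theorem[OF p(1)])
      hence "[(?h ^ D) ^ ord p 2 = 1] (mod p)" by (simp add: ord Dt flip: power_mult)
      thus ?thesis unfolding eq using roots_of_unity_mod_powers[OF p(1), of 2 "?h ^ D"] ord t by simp
    qed
  qed
  thus ?thesis by (simp add: cardL D_def)
qed

section \<open>Choice of the parameters for a given exponent\<close>

theorem theorem13:
  assumes "infinite {t::nat. t > 0 \<and>
             real (largest_prime_factor (2 ^ t - 1)) > 2 powr (0.75 * real t)}"
  shows "\<forall>\<gamma>::real. \<gamma> > 0 \<longrightarrow>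
           (\<exists>(c::real) (\<delta>::real) (\<epsilon>::real). c > 0 \<and> \<delta> > 0 \<and> \<epsilon> < 1/2 \<and>
             (\<forall>n::nat. n \<ge> 1 \<longrightarrow>
               (\<exists>(N::nat) (C :: bool list \<Rightarrow> bool list).
                  real N \<le> exp (c * real n powr \<gamma>) \<and>
                  locally_decodable n N C 3 \<delta> \<epsilon>)))"
proof (intro allI impI)
  fix \<gamma> :: real assume \<gamma>: "\<gamma> > 0"
  \<comment> \<open>One \<open>t\<close> with \<open>1 / t \<le> \<gamma>\<close> is fixed for all
    \<open>n\<close>, so \<open>p\<close>, the radius and \<open>c\<close> do not depend on
    \<open>n\<close>.\<close>
  obtain t where t: "t > max 1 (nat \<lceil>1 / \<gamma>\<rceil>)"
      and large: "real (largest_prime_factor (2 ^ t - 1)) > 2 powr (0.75 * real t)"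
    using assms unfolding infinite_nat_iff_unbounded by blast
  define p where "p = largest_prime_factor (2 ^ t - 1)"
  have t1: "t > 1" using t by simp
  \<comment> \<open>Thus \<open>2 ^ t - 1\<close> is at least 3, and its largest prime factor is the
    maximum of a nonempty set.\<close>
  have "(2::nat) ^ 2 \<le> 2 ^ t" using t1 by (intro power_increasing) auto
  hence "prime_factors ((2::nat) ^ t - 1) \<noteq> {}"
    by (auto simp: prime_factorization_empty_iff)
  hence "p \<in> prime_factors (2 ^ t - 1)"
    unfolding p_def largest_prime_factor_def by (intro Max_in) auto
  hence p: "prime p" "p dvd 2 ^ t - 1" by auto
  have large: "real p > 2 powr (0.75 * real t)" using large by (simp add: p_def)
  have p1: "p > 1" using prime_gt_1_nat[OF p(1)] .
  have "1 / \<gamma> \<le> real t" using t by linarith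
  hence t\<gamma>: "1 / real t \<le> \<gamma>" using \<gamma> t1 by (simp add: field_simps)
  define D where "D = (p - 1) div t"
  \<comment> \<open>The factor 2 pays for rounding \<open>r\<close> up to \<open>k\<close>; the
    logarithm converts powers of \<open>p\<close> to \<open>exp\<close>.\<close>
  define c where "c = ln (real p) * (2 * real p) ^ D"
  have c: "c > 0" using p1 by (simp add: c_def)
  have "\<exists>N C. real N \<le> exp (c * real n powr \<gamma>) \<and> locally_decodable n N C 3 (1 / (12 * real p)) (1 / 4)"
    if n: "n \<ge> 1" for n
  proof -
    \<comment> \<open>Here \<open>r ^ (p - 1) = n\<close>, so \<open>k ^ D\<close> grows like
      \<open>n\<close> to the power \<open>D / (p - 1)\<close>, which is at most
      \<open>1 / t\<close>.\<close>
    define r where "r = real n powr (1 / real (p - 1))"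
    define k where "k = nat \<lceil>r\<rceil>"
    have r1: "r \<ge> 1" unfolding r_def using n by (intro ge_one_powr_ge_zero) auto
    have k: "r \<le> real k" "real k \<le> 2 * r" "k > 0" using r1 unfolding k_def by linarith+
    have "real n = r ^ (p - 1)"
      using n p1 by (simp add: r_def powr_powr flip: powr_realpow)
    also have "\<dots> \<le> real k ^ (p - 1)" using k r1 by (intro power_mono) auto
    finally have nk: "n \<le> k ^ (p - 1)" by (simp flip: of_nat_power)
    obtain C where C: "locally_decodable n (p ^ ((p * k) ^ D)) C 3 (1 / (12 * real p)) (1 / 4)"
      using locally_decodable_prime_factor[OF p large t1 nk k(3)] unfolding D_def by blast
    have "real (D * t) \<le> real (p - 1)" unfolding D_def of_nat_le_iff by (rule div_times_less_eq_dividend)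
    hence "real D / real (p - 1) \<le> 1 / real t"
      using p1 t1 by (simp add: field_simps del: of_nat_diff)
    hence D\<gamma>: "real D / real (p - 1) \<le> \<gamma>" using t\<gamma> by (rule order.trans)
    have "real ((p * k) ^ D) \<le> (real p * (2 * r)) ^ D"
      using k by (simp, intro power_mono mult_left_mono) auto
    also have "\<dots> = (2 * real p) ^ D * r ^ D" by (simp add: power_mult_distrib)
    also have "r ^ D = real n powr (real D / real (p - 1))"
      using n by (simp add: r_def powr_powr flip: powr_realpow)
    also have "(2 * real p) ^ D * \<dots> \<le> (2 * real p) ^ D * real n powr \<gamma>"
      using n D\<gamma> by (intro mult_left_mono powr_mono) auto
    finally have "ln (real p) * real ((p * k) ^ D) \<le> c * real n powr \<gamma>"
      using p1 unfolding c_def mult.assoc by (intro mult_left_mono) auto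
    moreover have "real (p ^ m) = exp (ln (real p) * real m)" for m
      using p1 by (simp add: exp_of_nat2_mult)
    ultimately have "real (p ^ ((p * k) ^ D)) \<le> exp (c * real n powr \<gamma>)" by (simp only: exp_le_cancel_iff)
    with C show ?thesis by blast
  qed
  moreover have "1 / (12 * real p) > 0" using p1 by simp
  ultimately show "\<exists>c \<delta> \<epsilon>. c > 0 \<and> \<delta> > 0 \<and> \<epsilon> < 1/2 \<and> (\<forall>n\<ge>1. \<exists>N C.
      real N \<le> exp (c * real n powr \<gamma>) \<and> locally_decodable n N C 3 \<delta> \<epsilon>)"
    using c by (intro exI[of _ c] exI[of _ "1 / (12 * real p)"] exI[of _ "1 / 4 :: real"]) auto
qed

end
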